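(* The functor $\mathcal{T}:\mathbf{eSing\text{-}2Cob}\to R\text{-}\mathbf{Mod}$ satisfies the local relations (S), (T), (UFO), (G2), (SF) of the universal dot-free $sl(2)$ foam theory. Explicitly, writing $\iota,\epsilon,m,\Delta$ for the unit, counit, multiplication and comultiplication cobordisms of an oriented circle ($0_-$ or $0_+$, as appropriate), $H=m\circ\Delta$ for the genus-one cylinder, and $F:0_-\to 0_+$ for the composite $(\text{cozipper }1\to 0_+)\circ(\text{zipper }0_-\to 1)$: - (S) $\mathcal{T}(\epsilon\circ\iota)=0$ (sphere); - (T) $\mathcal{T}(\epsilon\circ H\circ\iota)=2$ (torus); - (UFO) $\mathcal{T}(\epsilon\circ F\circ\iota)=0$, $\mathcal{T}(\epsilon\circ H\circ F\circ H\circ\iota)=0$, $\mathcal{T}(\epsilon\circ H\circ F\circ\iota)=2i$, $\mathcal{T}(\epsilon\circ F\circ H\circ\iota)=-2i$; - (G2) $\mathcal{T}(H\circ H\circ\iota)=(h^2+4a)\,\mathcal{T}(\iota)$; - (SF) $\mathcal{T}(\mathrm{id})=\tfrac12\,\mathcal{T}(\iota\circ\epsilon\circ H)+\tfrac12\,\mathcal{T}(H\circ\iota\circ\epsilon)$, where $\mathrm{id}$ is the cylinder over the circle.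
   Context: $R=\mathbb{Z}[\tfrac12,i][a,h]$ with $i^2=-1$ and $a,h$ formal variables. Morphisms $R\to R$ are identified with elements of $R$. **The category.** Objects of $\mathbf{Sing\text{-}2Cob}$ are finite sequences with entries in $\{0_+,0_-,1\}$, where $0_+$, $0_-$ are a fixed positively and a fixed negatively oriented circle, and $1$ is a fixed bi-web (a closed piecewise oriented 1-manifold with exactly two bivalent vertices, one a sink and one a source). Morphisms are singular 2-cobordisms (piecewise oriented surfaces with singular arcs/circles along which orientations disagree), up to diffeomorphism rel boundary, generated by: unit, counit, multiplication, comultiplication cobordisms for each of $0_-$, $0_+$, $1$; the zippers $0_-\to 1$ and $0_+\to 1$; the cozippers $1\to 0_-$ and $1\to 0_+$; identities and permutations. $\mathbf{eSing\text{-}2Cob}$ is obtained by allowing $R$-linear combinations of morphisms and imposing $$\text{zip}_-\circ\text{cozip}_-=-i\,\mathrm{id}_1,\quad \text{cozip}_-\circ\text{zip}_-=-i\,\mathrm{id}_{0_-},\quad \text{zip}_+\circ\text{cozip}_+=i\,\mathrm{id}_1,\quad \text{cozip}_+\circ\text{zip}_+=i\,\mathrm{id}_{0_+},$$ where $\text{zip}_\pm:0_\pm\to 1$ and $\text{cozip}_\pm:1\to 0_\pm$. **The functor.** $\mathcal{A}=R[X]/(X^2-hX-a)$ carries two commutative Frobenius algebra structures with the usual unit $\iota_C=\iota_W$ and multiplication $m_C=m_W$: - $\mathcal{A}_C$: $\epsilon_C(1)=0$, $\epsilon_C(X)=1$, $\Delta_C(1)=1\otimes X+X\otimes 1-h\,1\otimes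 1$, $\Delta_C(X)=X\otimes X+a\,1\otimes 1$; - $\mathcal{A}_W$: $\epsilon_W=-i\,\epsilon_C$, $\Delta_W=i\,\Delta_C$. $R$-linear maps: $z_1:\mathcal{A}_C\to\mathcal{A}_W$, $1\mapsto1$, $X\mapsto X$; $z_1^*:\mathcal{A}_W\to\mathcal{A}_C$, $1\mapsto -i$, $X\mapsto -iX$; $z_2:\mathcal{A}_C\to\mathcal{A}_W$, $1\mapsto 1$, $X\mapsto h-X$; $z_2^*:\mathcal{A}_W\to\mathcal{A}_C$, $1\mapsto i$, $X\mapsto i(h-X)$. $\mathcal{T}$ is the $R$-linear symmetric monoidal functor with $\mathcal{T}(\emptyset)=R$, $\mathcal{T}(0_-)=\mathcal{T}(0_+)=\mathcal{A}_C$, $\mathcal{T}(1)=\mathcal{A}_W$, sending the unit, counit, multiplication, comultiplication cobordisms of $0_\pm$ to $\iota_C,\epsilon_C,m_C,\Delta_C$ and those of $1$ to $\iota_W,\epsilon_W,m_W,\Delta_W$, and $\text{zip}_-\mapsto z_1$, $\text{cozip}_-\mapsto z_1^*$, $\text{zip}_+\mapsto z_2$, $\text{cozip}_+\mapsto z_2^*$. In particular $F\mapsto z_2^*\circ z_1$. *)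

theory Defs
  imports Complex_Main
    "HOL-Computational_Algebra.Polynomial"
    "HOL-Library.Poly_Mapping"
    "HOL-Library.FuncSet"
begin

section \<open>The ground ring\<close>

text \<open>\<open>ring_Z2i\<close> is \<open>\<int>[1/2, i]\<close>, realised as a subring of the complex numbers.\<close>

typedef ring_Z2i =
  "{z. \<exists>(x::int) (y::int) (n::nat). z = (of_int x + of_int y * \<i>) / 2 ^ n}"
  by (rule exI[of _ 0]) (auto intro: exI[of _ 0])

setup_lifting type_definition_ring_Z2i

instantiation ring_Z2i :: idom
begin

lift_definition zero_ring_Z2i :: ring_Z2i is 0
  by (auto intro: exI[of _ 0])

lift_definition one_ring_Z2i :: ring_Z2i is 1
  by (rule exI[of _ 1], rule exI[of _ 0], rule exI[of _ 0]) simp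

lift_definition uminus_ring_Z2i :: "ring_Z2i \<Rightarrow> ring_Z2i" is uminus
proof -
  fix z :: complex
  assume "\<exists>(x::int) (y::int) n. z = (of_int x + of_int y * \<i>) / 2 ^ n"
  then obtain x y :: int and n where "z = (of_int x + of_int y * \<i>) / 2 ^ n" by blast
  then have "- z = (of_int (- x) + of_int (- y) * \<i>) / 2 ^ n"
    by (simp add: field_simps)
  then show "\<exists>(x::int) (y::int) n. - z = (of_int x + of_int y * \<i>) / 2 ^ n" by blast
qed

lift_definition plus_ring_Z2i :: "ring_Z2i \<Rightarrow> ring_Z2i \<Rightarrow> ring_Z2i" is "(+)"
proof -
  fix z w :: complex
  assume "\<exists>(x::int) (y::int) n. z = (of_int x + of_int y * \<i>) / 2 ^ n"
    and "\<exists>(x::int) (y::int) n. w = (of_int x + of_int y * \<i>) / 2 ^ n"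
  then obtain x y x' y' :: int and n n' where
    "z = (of_int x + of_int y * \<i>) / 2 ^ n" "w = (of_int x' + of_int y' * \<i>) / 2 ^ n'" by blast
  then have "z + w = (of_int (x * 2 ^ n' + x' * 2 ^ n) + of_int (y * 2 ^ n' + y' * 2 ^ n) * \<i>) / 2 ^ (n + n')"
    by (simp only:) (simp add: field_simps power_add)
  then show "\<exists>(x::int) (y::int) n. z + w = (of_int x + of_int y * \<i>) / 2 ^ n" by blast
qed

lift_definition minus_ring_Z2i :: "ring_Z2i \<Rightarrow> ring_Z2i \<Rightarrow> ring_Z2i" is "(-)"
proof -
  fix z w :: complex
  assume "\<exists>(x::int) (y::int) n. z = (of_int x + of_int y * \<i>) / 2 ^ n"
    and "\<exists>(x::int) (y::int) n. w = (of_int x + of_int y * \<i>) / 2 ^ n"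
  then obtain x y x' y' :: int and n n' where
    "z = (of_int x + of_int y * \<i>) / 2 ^ n" "w = (of_int x' + of_int y' * \<i>) / 2 ^ n'" by blast
  then have "z - w = (of_int (x * 2 ^ n' - x' * 2 ^ n) + of_int (y * 2 ^ n' - y' * 2 ^ n) * \<i>) / 2 ^ (n + n')"
    by (simp only:) (simp add: field_simps power_add)
  then show "\<exists>(x::int) (y::int) n. z - w = (of_int x + of_int y * \<i>) / 2 ^ n" by blast
qed

lift_definition times_ring_Z2i :: "ring_Z2i \<Rightarrow> ring_Z2i \<Rightarrow> ring_Z2i" is "(*)"
proof -
  fix z w :: complex
  assume "\<exists>(x::int) (y::int) n. z = (of_int x + of_int y * \<i>) / 2 ^ n"
    and "\<exists>(x::int) (y::int) n. w = (of_int x + of_int y * \<i>) / 2 ^ n"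
  then obtain x y x' y' :: int and n n' where
    "z = (of_int x + of_int y * \<i>) / 2 ^ n" "w = (of_int x' + of_int y' * \<i>) / 2 ^ n'" by blast
  then have "z * w = (of_int (x * x' - y * y') + of_int (x * y' + y * x') * \<i>) / 2 ^ (n + n')"
    by (simp only:) (simp add: field_simps power_add)
  then show "\<exists>(x::int) (y::int) n. z * w = (of_int x + of_int y * \<i>) / 2 ^ n" by blast
qed

instance
  by standard (transfer, simp add: algebra_simps)+

end

lift_definition i_Z2i :: ring_Z2i is \<i>
  by (rule exI[of _ 0], rule exI[of _ 1], rule exI[of _ 0]) simp

lift_definition half_Z2i :: ring_Z2i is "1 / 2"
  by (rule exI[of _ 1], rule exI[of _ 0], rule exI[of _ 1]) simp

text \<open>\<open>R = \<int>[1/2, i][a, h]\<close>, with \<open>a\<close> the inner and \<open>h\<close> the outer variable.\<close>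

type_synonym R = "ring_Z2i poly poly"

definition i_R :: R where "i_R = [:[:i_Z2i:]:]"
definition half_R :: R where "half_R = [:[:half_Z2i:]:]"
definition a_R :: R where "a_R = [:[:0, 1:]:]"
definition h_R :: R where "h_R = [:0, 1:]"

lemma i_R_square: "i_R * i_R = - 1"
proof -
  have "i_Z2i * i_Z2i = - 1" by transfer simp
  then show ?thesis by (simp add: i_R_def one_pCons)
qed

lemma two_half_R: "2 * half_R = 1"
proof -
  have "half_Z2i + half_Z2i = 1" by transfer simp
  then have "half_R + half_R = 1" by (simp add: half_R_def one_pCons)
  then show ?thesis by (simp only: mult_2)
qed


section \<open>The algebra \<open>\<A> = R[X]/(X\<^sup>2 - hX - a)\<close>\<close>

definition modulus :: "R poly" where
  "modulus = [:- a_R, - h_R, 1:]"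

definition alg_rel :: "R poly \<Rightarrow> R poly \<Rightarrow> bool" where
  "alg_rel p q \<longleftrightarrow> modulus dvd (p - q)"

lemma degree_modulus: "degree modulus = 2"
  by (simp add: modulus_def)

quotient_type alg = "R poly" / alg_rel
proof (rule equivpI)
  show "reflp alg_rel" by (simp add: reflp_def alg_rel_def)
  show "symp alg_rel"
    by (rule sympI) (simp only: alg_rel_def, subst dvd_minus_iff[symmetric], simp)
  show "transp alg_rel"
  proof (rule transpI)
    fix p q r assume "alg_rel p q" "alg_rel q r"
    then show "alg_rel p r"
      unfolding alg_rel_def using dvd_add[of modulus "p - q" "q - r"] by simp
  qed
qed

instantiation alg :: comm_ring_1
begin

lift_definition zero_alg :: alg is 0 .
lift_definition one_alg :: alg is 1 .
lift_definition uminus_alg :: "alg \<Rightarrow> alg" is uminus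
  by (simp only: alg_rel_def minus_diff_minus dvd_minus_iff)
lift_definition plus_alg :: "alg \<Rightarrow> alg \<Rightarrow> alg" is "(+)"
  by (simp only: alg_rel_def add_diff_add dvd_add)
lift_definition minus_alg :: "alg \<Rightarrow> alg \<Rightarrow> alg" is "(-)"
proof -
  fix p p' q q' assume "alg_rel p p'" "alg_rel q q'"
  then have "modulus dvd (p - p') - (q - q')"
    unfolding alg_rel_def by (rule dvd_diff)
  then show "alg_rel (p - q) (p' - q')"
    by (simp add: alg_rel_def algebra_simps)
qed
lift_definition times_alg :: "alg \<Rightarrow> alg \<Rightarrow> alg" is "(*)"
proof -
  fix p p' q q' assume "alg_rel p p'" "alg_rel q q'"
  moreover have eq: "p * q - p' * q' = (p - p') * q + p' * (q - q')" by (simp add: algebra_simps)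
  ultimately show "alg_rel (p * q) (p' * q')"
    unfolding alg_rel_def eq by (intro dvd_add dvd_mult2 dvd_mult)
qed

instance
proof
  show "(0::alg) \<noteq> 1"
  proof (transfer)
    show "\<not> alg_rel 0 1"
    proof
      assume "alg_rel 0 1"
      then have "modulus dvd 1" by (simp add: alg_rel_def)
      then have "degree modulus \<le> degree (1 :: R poly)" by (rule dvd_imp_degree_le) simp
      then show False by (simp add: degree_modulus)
    qed
  qed
qed (transfer, simp add: alg_rel_def algebra_simps)+

end

definition of_R :: "R \<Rightarrow> alg" where "of_R r = abs_alg [:r:]"
lift_definition X_A :: alg is "[:0, 1:]" .

lemma of_R_hom:
  "of_R 0 = 0" "of_R 1 = 1" "of_R (r + s) = of_R r + of_R s"
  "of_R (r * s) = of_R r * of_R s" "of_R (- r) = - of_R r" "of_R (r - s) = of_R r - of_R s"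
  unfolding of_R_def zero_alg_def one_alg_def
  by (simp_all add: plus_alg.abs_eq times_alg.abs_eq uminus_alg.abs_eq minus_alg.abs_eq one_pCons mult.commute)

lemma of_R_basis: "of_R r + of_R s * X_A = abs_alg [:r, s:]"
  by (simp add: of_R_def X_A_def plus_alg.abs_eq times_alg.abs_eq)

lemma X_A_square: "X_A * X_A = of_R h_R * X_A + of_R a_R"
proof -
  have "[:0, 1:] * [:0, 1:] - [:a_R, h_R:] = modulus"
    by (simp add: modulus_def)
  then have "alg_rel ([:0, 1:] * [:0, 1:]) [:a_R, h_R:]"
    unfolding alg_rel_def by simp
  then have "X_A * X_A = abs_alg [:a_R, h_R:]"
    by (simp add: X_A_def times_alg.abs_eq alg.abs_eq_iff)
  then show ?thesis by (metis of_R_basis add.commute)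
qed

lemma basis_exists: "\<exists>r s. x = of_R r + of_R s * X_A"
proof -
  obtain p where x: "x = abs_alg p" by (metis Quotient_alg Quotient_abs_rep)
  have "\<exists>r s. modulus dvd (p - [:r, s:])"
  proof (induction p)
    case 0
    show ?case by (rule exI[of _ 0], rule exI[of _ 0]) simp
  next
    case (pCons c p)
    then obtain r s k where "p = [:r, s:] + modulus * k"
      by (metis add.commute diff_add_cancel dvdE)
    moreover have "[:0, s:] * [:0, 1:] = smult s modulus + [:s * a_R, s * h_R:]"
      by (simp add: modulus_def)
    moreover have "pCons c p = [:c:] + [:0, 1:] * p" by simp
    moreover have "[:c + s * a_R, r + s * h_R:] = [:c:] + [:0, r:] + [:s * a_R, s * h_R:]"
      by simp
    moreover have "[:0, 1:] * [:r, s:] = [:0, r:] + [:0, s:] * [:0, 1:]" by simp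
    ultimately have "pCons c p - [:c + s * a_R, r + s * h_R:]
        = [:0, 1:] * (modulus * k) + smult s modulus"
      by (simp only: distrib_left) (simp only: algebra_simps)
    also have "\<dots> = modulus * ([:0, 1:] * k + [:s:])"
      by (simp add: distrib_left)
    finally have "pCons c p - [:c + s * a_R, r + s * h_R:] = modulus * ([:0, 1:] * k + [:s:])" .
    then show ?case by (metis dvd_triv_left)
  qed
  then show ?thesis
    by (simp add: x of_R_basis alg.abs_eq_iff alg_rel_def)
qed

lemma basis_unique:
  assumes "of_R r + of_R s * X_A = of_R r' + of_R s' * X_A"
  shows "r = r' \<and> s = s'"
proof -
  have "modulus dvd [:r - r', s - s':]"
    using assms by (simp add: of_R_basis alg.abs_eq_iff alg_rel_def)
  moreover have "degree [:r - r', s - s':] < degree modulus"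
    by (simp add: degree_modulus)
  ultimately have "[:r - r', s - s':] = 0"
    by (meson dvd_imp_degree_le linorder_not_le)
  then show ?thesis by simp
qed

text \<open>Coordinates with respect to the \<open>R\<close>-basis \<open>1, X\<close>.\<close>

definition coord_1 :: "alg \<Rightarrow> R" where
  "coord_1 x = (THE r. \<exists>s. x = of_R r + of_R s * X_A)"

definition coord_X :: "alg \<Rightarrow> R" where
  "coord_X x = (THE s. \<exists>r. x = of_R r + of_R s * X_A)"

lemma coord_basis [simp]:
  "coord_1 (of_R r + of_R s * X_A) = r" "coord_X (of_R r + of_R s * X_A) = s"
  unfolding coord_1_def coord_X_def by (blast dest: basis_unique)+


section \<open>Tensor powers of \<open>\<A>\<close>\<close>

text \<open>
  The tensor algebra of the \<open>R\<close>-module \<open>\<A>\<close>: the free noncommutative \<open>R\<close>-algebra on the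
  set \<open>\<A>\<close> (the monoid algebra of the monoid of words in \<open>\<A>\<close>) modulo the two-sided ideal
  generated by the \<open>R\<close>-linearity relations. Its product is the tensor product, and its
  part of degree \<open>n\<close> is the \<open>n\<close>-fold tensor power of \<open>\<A>\<close> over \<open>R\<close>. The algebra
  structure of \<open>\<A>\<close> plays no role in the construction.
\<close>

datatype word = Word (letters: "alg list")

instantiation word :: monoid_add
begin
definition "0 = Word []"
definition "u + v = Word (letters u @ letters v)"
instance by standard (auto simp: zero_word_def plus_word_def)
end

definition letter :: "alg \<Rightarrow> word \<Rightarrow>\<^sub>0 R" where
  "letter x = Poly_Mapping.single (Word [x]) 1"

inductive tensor_null :: "(word \<Rightarrow>\<^sub>0 R) \<Rightarrow> bool" where
  add: "tensor_null (letter (x + y) - (letter x + letter y))"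
| scale: "tensor_null (letter (of_R r * x) - Poly_Mapping.single 0 r * letter x)"
| zero: "tensor_null 0"
| sum: "tensor_null p \<Longrightarrow> tensor_null q \<Longrightarrow> tensor_null (p + q)"
| mult_left: "tensor_null p \<Longrightarrow> tensor_null (q * p)"
| mult_right: "tensor_null p \<Longrightarrow> tensor_null (p * q)"

definition tensor_rel :: "(word \<Rightarrow>\<^sub>0 R) \<Rightarrow> (word \<Rightarrow>\<^sub>0 R) \<Rightarrow> bool" where
  "tensor_rel p q \<longleftrightarrow> tensor_null (p - q)"

lemma tensor_null_uminus: "tensor_null p \<Longrightarrow> tensor_null (- p)"
  using tensor_null.mult_left[of p "- 1"] by simp

quotient_type tensor = "word \<Rightarrow>\<^sub>0 R" / tensor_rel
proof (rule equivpI)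
  show "reflp tensor_rel" by (simp add: reflp_def tensor_rel_def tensor_null.zero)
  show "symp tensor_rel"
  proof (rule sympI)
    fix p q assume "tensor_rel p q"
    then show "tensor_rel q p"
      unfolding tensor_rel_def using tensor_null_uminus[of "p - q"] by simp
  qed
  show "transp tensor_rel"
  proof (rule transpI)
    fix p q r assume "tensor_rel p q" "tensor_rel q r"
    then show "tensor_rel p r"
      unfolding tensor_rel_def using tensor_null.sum[of "p - q" "q - r"] by simp
  qed
qed

text \<open>Iterated multiplication \<open>x\<^sub>1 \<otimes> \<dots> \<otimes> x\<^sub>n \<mapsto> x\<^sub>1 \<cdots> x\<^sub>n\<close>, first on the free algebra.\<close>

definition free_product :: "(word \<Rightarrow>\<^sub>0 R) \<Rightarrow> alg" where
  "free_product p = (\<Sum>w \<in> Poly_Mapping.keys p. of_R (Poly_Mapping.lookup p w) * prod_list (letters w))"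

lemma free_product_superset:
  assumes "finite S" "Poly_Mapping.keys p \<subseteq> S"
  shows "free_product p = (\<Sum>w \<in> S. of_R (Poly_Mapping.lookup p w) * prod_list (letters w))"
  unfolding free_product_def
  by (rule sum.mono_neutral_left) (use assms in \<open>auto simp: in_keys_iff of_R_hom\<close>)

lemma free_product_add: "free_product (p + q) = free_product p + free_product q"
proof -
  let ?S = "Poly_Mapping.keys p \<union> Poly_Mapping.keys q"
  have "Poly_Mapping.keys (p + q) \<subseteq> ?S" by (rule Poly_Mapping.keys_add)
  then show ?thesis
    by (simp add: free_product_superset[of ?S] lookup_add of_R_hom distrib_right sum.distrib)
qed

lemma free_product_single: "free_product (Poly_Mapping.single w r) = of_R r * prod_list (letters w)"
  by (cases "r = 0") (auto simp: free_product_def of_R_hom)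

lemma free_product_zero: "free_product 0 = 0"
  by (simp add: free_product_def)

lemma free_product_uminus: "free_product (- p) = - free_product p"
  by (metis add.right_inverse add_eq_0_iff free_product_add free_product_zero)

lemma free_product_diff: "free_product (p - q) = free_product p - free_product q"
  using free_product_add[of p "- q"] by (simp add: free_product_uminus)

lemma free_algebra_induct:
  fixes p :: "word \<Rightarrow>\<^sub>0 R"
  assumes "P 0" "\<And>w r. P (Poly_Mapping.single w r)" "\<And>p q. P p \<Longrightarrow> P q \<Longrightarrow> P (p + q)"
  shows "P p"
proof (induction p rule: update_induct)
  case const
  show ?case by (rule assms)
next
  case (update p w r)
  have "Poly_Mapping.update w r p = p + Poly_Mapping.single w r"
    by (rule poly_mapping_eqI)
      (use update in \<open>auto simp: lookup_update lookup_add lookup_single in_keys_iff when_def\<close>)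
  then show ?case using update assms by simp
qed

lemma free_product_mult: "free_product (p * q) = free_product p * free_product q"
proof (induction p rule: free_algebra_induct)
  case 1
  show ?case by (simp add: free_product_zero)
next
  case (2 w r)
  show ?case
  proof (induction q rule: free_algebra_induct)
    case 1
    show ?case by (simp add: free_product_zero)
  next
    case (2 w' r')
    show ?case
      by (simp add: mult_single free_product_single plus_word_def of_R_hom algebra_simps)
  next
    case (3 q q')
    then show ?case by (simp add: distrib_left free_product_add)
  qed
next
  case (3 p p')
  then show ?case by (simp add: distrib_right free_product_add)
qed

lemma free_product_letter: "free_product (letter x) = x"
  by (simp add: letter_def free_product_single of_R_hom)

lemma free_product_null: "tensor_null p \<Longrightarrow> free_product p = 0"
  by (induction rule: tensor_null.induct)
    (simp_all add: free_product_diff free_product_add free_product_mult free_product_letter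
      free_product_single free_product_zero zero_word_def)

instantiation tensor :: ring_1
begin

lift_definition zero_tensor :: tensor is 0 .
lift_definition one_tensor :: tensor is 1 .
lift_definition uminus_tensor :: "tensor \<Rightarrow> tensor" is uminus
  by (simp only: tensor_rel_def minus_diff_minus tensor_null_uminus)
lift_definition plus_tensor :: "tensor \<Rightarrow> tensor \<Rightarrow> tensor" is "(+)"
  by (simp only: tensor_rel_def add_diff_add tensor_null.sum)
lift_definition minus_tensor :: "tensor \<Rightarrow> tensor \<Rightarrow> tensor" is "(-)"
proof -
  fix p p' q q' assume "tensor_rel p p'" "tensor_rel q q'"
  moreover have eq: "(p - q) - (p' - q') = (p - p') + - (q - q')" by simp
  ultimately show "tensor_rel (p - q) (p' - q')"
    unfolding tensor_rel_def eq by (intro tensor_null.sum tensor_null_uminus)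
qed
lift_definition times_tensor :: "tensor \<Rightarrow> tensor \<Rightarrow> tensor" is "(*)"
proof -
  fix p p' q q' assume "tensor_rel p p'" "tensor_rel q q'"
  moreover have eq: "p * q - p' * q' = (p - p') * q + p' * (q - q')" by (simp add: algebra_simps)
  ultimately show "tensor_rel (p * q) (p' * q')"
    unfolding tensor_rel_def eq
    by (intro tensor_null.sum tensor_null.mult_right tensor_null.mult_left)
qed

instance
proof
  show "(0::tensor) \<noteq> 1"
  proof (transfer)
    show "\<not> tensor_rel 0 1"
    proof
      assume "tensor_rel 0 1"
      then have "free_product (0 - 1) = 0"
        unfolding tensor_rel_def by (rule free_product_null)
      then have "free_product (Poly_Mapping.single 0 1) = 0"
        by (simp add: free_product_uminus)
      then show False by (simp only: free_product_single) (simp add: zero_word_def of_R_hom)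
    qed
  qed
qed (transfer, simp add: tensor_rel_def tensor_null.zero algebra_simps)+

end

text \<open>The tensor product of \<open>s\<close> and \<open>t\<close> is \<open>s * t\<close>, and the scalar multiple \<open>r t\<close> is \<open>scal r * t\<close>.\<close>

definition scal :: "R \<Rightarrow> tensor" where "scal r = abs_tensor (Poly_Mapping.single 0 r)"
definition inj_A :: "alg \<Rightarrow> tensor" where "inj_A x = abs_tensor (letter x)"

definition tensor_power :: "nat \<Rightarrow> tensor set" where
  "tensor_power n = abs_tensor ` {p. \<forall>w \<in> Poly_Mapping.keys p. length (letters w) = n}"

text \<open>
  \<open>mult_A\<close> sends \<open>x\<^sub>1 \<otimes> \<dots> \<otimes> x\<^sub>n\<close> to \<open>x\<^sub>1 \<cdots> x\<^sub>n\<close>. On \<open>\<A> \<otimes> \<A>\<close> it is the multiplication of \<open>\<A>\<close>,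
  and on the first tensor power it is the canonical isomorphism to \<open>\<A>\<close>, inverse to \<open>inj_A\<close>.
\<close>

definition mult_A :: "tensor \<Rightarrow> alg" where
  "mult_A t = free_product (rep_tensor t)"

lemma mult_A_abs [simp]: "mult_A (abs_tensor p) = free_product p"
proof -
  have "tensor_rel (rep_tensor (abs_tensor p)) p"
    by (metis Quotient_tensor Quotient_abs_rep tensor.abs_eq_iff)
  then show ?thesis
    unfolding mult_A_def tensor_rel_def
    by (metis free_product_null free_product_diff eq_iff_diff_eq_0)
qed

lemma mult_A_inj_A [simp]: "mult_A (inj_A x) = x"
  by (simp add: inj_A_def free_product_letter)

lemma abs_tensor_cases: obtains p where "t = abs_tensor p"
  by (metis Quotient_tensor Quotient_abs_rep)

lemma mult_A_hom:
  "mult_A (s + t) = mult_A s + mult_A t" "mult_A (s * t) = mult_A s * mult_A t"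
  "mult_A (scal r) = of_R r"
  by (cases s rule: abs_tensor_cases, cases t rule: abs_tensor_cases,
      simp add: scal_def plus_tensor.abs_eq times_tensor.abs_eq free_product_add
        free_product_mult free_product_single zero_word_def)+

lemma scal_inject: "scal r = scal s \<longleftrightarrow> r = s"
proof
  assume "scal r = scal s"
  then have "of_R r + of_R 0 * X_A = of_R s + of_R 0 * X_A"
    by (metis mult_A_hom(3))
  then show "r = s" by (blast dest: basis_unique)
qed simp


section \<open>\<open>R\<close>-linear maps between tensor powers\<close>

definition linear_maps :: "nat \<Rightarrow> nat \<Rightarrow> (tensor \<Rightarrow> tensor) set" where
  "linear_maps n m = {f \<in> tensor_power n \<rightarrow>\<^sub>E tensor_power m.
     (\<forall>s \<in> tensor_power n. \<forall>t \<in> tensor_power n. f (s + t) = f s + f t) \<and>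
     (\<forall>r. \<forall>t \<in> tensor_power n. f (scal r * t) = scal r * f t)}"

definition hom_add :: "nat \<Rightarrow> (tensor \<Rightarrow> tensor) \<Rightarrow> (tensor \<Rightarrow> tensor) \<Rightarrow> tensor \<Rightarrow> tensor" where
  "hom_add n f g = (\<lambda>t \<in> tensor_power n. f t + g t)"

definition hom_scale :: "nat \<Rightarrow> R \<Rightarrow> (tensor \<Rightarrow> tensor) \<Rightarrow> tensor \<Rightarrow> tensor" where
  "hom_scale n r f = (\<lambda>t \<in> tensor_power n. scal r * f t)"

text \<open>The endomorphism of the ground ring \<open>R\<close>, the zeroth tensor power, that an element of \<open>R\<close> stands for.\<close>

definition ground_map :: "R \<Rightarrow> tensor \<Rightarrow> tensor" where
  "ground_map r = (\<lambda>t \<in> tensor_power 0. scal r * t)"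


section \<open>The Frobenius algebras and the maps between them\<close>

definition iota :: "tensor \<Rightarrow> tensor" where
  "iota = (\<lambda>t \<in> tensor_power 0. t * inj_A 1)"

definition mult :: "tensor \<Rightarrow> tensor" where
  "mult = (\<lambda>t \<in> tensor_power 2. inj_A (mult_A t))"

text \<open>The \<open>R\<close>-linear map on \<open>\<A>\<close> that sends the basis element \<open>1\<close> to \<open>u\<close> and \<open>X\<close> to \<open>v\<close>.\<close>

definition basis_map :: "tensor \<Rightarrow> tensor \<Rightarrow> tensor \<Rightarrow> tensor" where
  "basis_map u v = (\<lambda>t \<in> tensor_power 1.
     scal (coord_1 (mult_A t)) * u + scal (coord_X (mult_A t)) * v)"

definition eps_C :: "tensor \<Rightarrow> tensor" where
  "eps_C = basis_map 0 1"

definition Delta_C :: "tensor \<Rightarrow> tensor" where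
  "Delta_C = basis_map
     (inj_A 1 * inj_A X_A + inj_A X_A * inj_A 1 - scal h_R * (inj_A 1 * inj_A 1))
     (inj_A X_A * inj_A X_A + scal a_R * (inj_A 1 * inj_A 1))"

definition eps_W :: "tensor \<Rightarrow> tensor" where
  "eps_W = hom_scale 1 (- i_R) eps_C"

definition Delta_W :: "tensor \<Rightarrow> tensor" where
  "Delta_W = hom_scale 1 i_R Delta_C"

definition z1 :: "tensor \<Rightarrow> tensor" where
  "z1 = basis_map (inj_A 1) (inj_A X_A)"

definition z1_star :: "tensor \<Rightarrow> tensor" where
  "z1_star = basis_map (inj_A (- of_R i_R)) (inj_A (- (of_R i_R * X_A)))"

definition z2 :: "tensor \<Rightarrow> tensor" where
  "z2 = basis_map (inj_A 1) (inj_A (of_R h_R - X_A))"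

definition z2_star :: "tensor \<Rightarrow> tensor" where
  "z2_star = basis_map (inj_A (of_R i_R)) (inj_A (of_R i_R * (of_R h_R - X_A)))"


section \<open>The category Sing-2Cob\<close>

text \<open>Objects are lists over the circles \<open>0\<^sub>-\<close>, \<open>0\<^sub>+\<close> and the bi-web \<open>1\<close>.\<close>

datatype ob = Circ_minus | Circ_plus | Bi_web

record 'm cob =
  Hom :: "ob list \<Rightarrow> ob list \<Rightarrow> 'm set"
  Comp :: "'m \<Rightarrow> 'm \<Rightarrow> 'm"
  Id :: "ob list \<Rightarrow> 'm"
  Tens :: "'m \<Rightarrow> 'm \<Rightarrow> 'm"
  Perm :: "ob list \<Rightarrow> ob list \<Rightarrow> 'm"
  Unit :: "ob \<Rightarrow> 'm"
  Counit :: "ob \<Rightarrow> 'm"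
  Mult :: "ob \<Rightarrow> 'm"
  Comult :: "ob \<Rightarrow> 'm"
  Zip_minus :: 'm
  Zip_plus :: 'm
  Cozip_minus :: 'm
  Cozip_plus :: 'm

inductive generated :: "'m cob \<Rightarrow> ob list \<Rightarrow> ob list \<Rightarrow> 'm \<Rightarrow> bool" for C where
  "generated C x x (Id C x)"
| "generated C (x @ y) (y @ x) (Perm C x y)"
| "generated C [] [c] (Unit C c)"
| "generated C [c] [] (Counit C c)"
| "generated C [c, c] [c] (Mult C c)"
| "generated C [c] [c, c] (Comult C c)"
| "generated C [Circ_minus] [Bi_web] (Zip_minus C)"
| "generated C [Circ_plus] [Bi_web] (Zip_plus C)"
| "generated C [Bi_web] [Circ_minus] (Cozip_minus C)"
| "generated C [Bi_web] [Circ_plus] (Cozip_plus C)"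
| "generated C x y f \<Longrightarrow> generated C y z g \<Longrightarrow> generated C x z (Comp C g f)"
| "generated C x y f \<Longrightarrow> generated C x' y' f' \<Longrightarrow> generated C (x @ x') (y @ y') (Tens C f f')"

text \<open>
  A strict symmetric monoidal category with these objects, whose morphisms are exactly
  those generated by the listed cobordisms; \<open>Perm C x y\<close> exchanges the blocks \<open>x\<close> and \<open>y\<close>. The elements of \<open>Hom C x y\<close> are the
  diffeomorphism classes of singular 2-cobordisms from \<open>x\<close> to \<open>y\<close>; no further
  property of diffeomorphism is required of them.
\<close>

locale sing_2cob =
  fixes C :: "'m cob"
  assumes hom_generated: "f \<in> Hom C x y \<longleftrightarrow> generated C x y f"
    and hom_disjoint: "f \<in> Hom C x y \<Longrightarrow> f \<in> Hom C x' y' \<Longrightarrow> x = x' \<and> y = y'"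
    and comp_assoc: "f \<in> Hom C x y \<Longrightarrow> g \<in> Hom C y z \<Longrightarrow> k \<in> Hom C z w \<Longrightarrow>
      Comp C k (Comp C g f) = Comp C (Comp C k g) f"
    and comp_id: "f \<in> Hom C x y \<Longrightarrow> Comp C f (Id C x) = f"
      "f \<in> Hom C x y \<Longrightarrow> Comp C (Id C y) f = f"
    and tens_comp: "f \<in> Hom C x y \<Longrightarrow> g \<in> Hom C y z \<Longrightarrow> f' \<in> Hom C x' y' \<Longrightarrow> g' \<in> Hom C y' z' \<Longrightarrow>
      Tens C (Comp C g f) (Comp C g' f') = Comp C (Tens C g g') (Tens C f f')"
    and tens_id: "Tens C (Id C x) (Id C y) = Id C (x @ y)"
    and tens_assoc: "f \<in> Hom C x y \<Longrightarrow> f' \<in> Hom C x' y' \<Longrightarrow> f'' \<in> Hom C x'' y'' \<Longrightarrow>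
      Tens C (Tens C f f') f'' = Tens C f (Tens C f' f'')"
    and tens_unit: "f \<in> Hom C x y \<Longrightarrow> Tens C f (Id C []) = f"
      "f \<in> Hom C x y \<Longrightarrow> Tens C (Id C []) f = f"
    and perm_natural: "f \<in> Hom C x y \<Longrightarrow> f' \<in> Hom C x' y' \<Longrightarrow>
      Comp C (Perm C y y') (Tens C f f') = Comp C (Tens C f' f) (Perm C x x')"
    and perm_inverse: "Comp C (Perm C y x) (Perm C x y) = Id C (x @ y)"
    and perm_hexagon: "Perm C x (y @ z) =
      Comp C (Tens C (Id C y) (Perm C x z)) (Tens C (Perm C x y) (Id C z))"


section \<open>The category eSing-2Cob\<close>

text \<open>
  Morphisms of eSing-2Cob from \<open>x\<close> to \<open>y\<close> are represented by elements of \<open>lin_hom C x y\<close>,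
  with bilinearly extended composition and tensor product. Two such elements represent
  the same morphism iff \<open>esing_eq C x y\<close> holds.
\<close>

definition lin_hom :: "'m cob \<Rightarrow> ob list \<Rightarrow> ob list \<Rightarrow> ('m \<Rightarrow>\<^sub>0 R) set" where
  "lin_hom C x y = {p. Poly_Mapping.keys p \<subseteq> Hom C x y}"

definition lin_cob :: "'m \<Rightarrow> 'm \<Rightarrow>\<^sub>0 R" where
  "lin_cob f = Poly_Mapping.single f 1"

definition lin_scale :: "R \<Rightarrow> ('m \<Rightarrow>\<^sub>0 R) \<Rightarrow> 'm \<Rightarrow>\<^sub>0 R" where
  "lin_scale r p = Poly_Mapping.map ((*) r) p"

definition lin_comp :: "'m cob \<Rightarrow> ('m \<Rightarrow>\<^sub>0 R) \<Rightarrow> ('m \<Rightarrow>\<^sub>0 R) \<Rightarrow> 'm \<Rightarrow>\<^sub>0 R" where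
  "lin_comp C q p = (\<Sum>g \<in> Poly_Mapping.keys q. \<Sum>f \<in> Poly_Mapping.keys p.
     Poly_Mapping.single (Comp C g f) (Poly_Mapping.lookup q g * Poly_Mapping.lookup p f))"

definition lin_tens :: "'m cob \<Rightarrow> ('m \<Rightarrow>\<^sub>0 R) \<Rightarrow> ('m \<Rightarrow>\<^sub>0 R) \<Rightarrow> 'm \<Rightarrow>\<^sub>0 R" where
  "lin_tens C p q = (\<Sum>f \<in> Poly_Mapping.keys p. \<Sum>g \<in> Poly_Mapping.keys q.
     Poly_Mapping.single (Tens C f g) (Poly_Mapping.lookup p f * Poly_Mapping.lookup q g))"

inductive esing_null :: "'m cob \<Rightarrow> ob list \<Rightarrow> ob list \<Rightarrow> ('m \<Rightarrow>\<^sub>0 R) \<Rightarrow> bool" for C where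
  zip_cozip_minus: "esing_null C [Bi_web] [Bi_web]
     (lin_cob (Comp C (Zip_minus C) (Cozip_minus C)) - lin_scale (- i_R) (lin_cob (Id C [Bi_web])))"
| cozip_zip_minus: "esing_null C [Circ_minus] [Circ_minus]
     (lin_cob (Comp C (Cozip_minus C) (Zip_minus C)) - lin_scale (- i_R) (lin_cob (Id C [Circ_minus])))"
| zip_cozip_plus: "esing_null C [Bi_web] [Bi_web]
     (lin_cob (Comp C (Zip_plus C) (Cozip_plus C)) - lin_scale i_R (lin_cob (Id C [Bi_web])))"
| cozip_zip_plus: "esing_null C [Circ_plus] [Circ_plus]
     (lin_cob (Comp C (Cozip_plus C) (Zip_plus C)) - lin_scale i_R (lin_cob (Id C [Circ_plus])))"
| zero: "esing_null C x y 0"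
| add: "esing_null C x y p \<Longrightarrow> esing_null C x y q \<Longrightarrow> esing_null C x y (p + q)"
| scale: "esing_null C x y p \<Longrightarrow> esing_null C x y (lin_scale r p)"
| comp_left: "esing_null C x y p \<Longrightarrow> q \<in> lin_hom C y z \<Longrightarrow> esing_null C x z (lin_comp C q p)"
| comp_right: "q \<in> lin_hom C x y \<Longrightarrow> esing_null C y z p \<Longrightarrow> esing_null C x z (lin_comp C p q)"
| tens_left: "q \<in> lin_hom C x y \<Longrightarrow> esing_null C x' y' p \<Longrightarrow>
     esing_null C (x @ x') (y @ y') (lin_tens C q p)"
| tens_right: "esing_null C x y p \<Longrightarrow> q \<in> lin_hom C x' y' \<Longrightarrow>
     esing_null C (x @ x') (y @ y') (lin_tens C p q)"

definition esing_eq :: "'m cob \<Rightarrow> ob list \<Rightarrow> ob list \<Rightarrow> ('m \<Rightarrow>\<^sub>0 R) \<Rightarrow> ('m \<Rightarrow>\<^sub>0 R) \<Rightarrow> bool" where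
  "esing_eq C x y p q \<longleftrightarrow> esing_null C x y (p - q)"


section \<open>The functor \<open>\<T>\<close>\<close>

text \<open>
  On objects \<open>\<T>\<close> sends a list of length \<open>n\<close> to the \<open>n\<close>-th tensor power of \<open>\<A>\<close>, the
  module underlying both \<open>\<A>\<^sub>C\<close> and \<open>\<A>\<^sub>W\<close>. On morphisms it is given on representatives
  (see \<open>T_eq\<close>).
\<close>

locale foam_functor = sing_2cob C
  for C :: "'m cob" +
  fixes T :: "ob list \<Rightarrow> ob list \<Rightarrow> ('m \<Rightarrow>\<^sub>0 R) \<Rightarrow> tensor \<Rightarrow> tensor"
  assumes T_linear_map: "p \<in> lin_hom C x y \<Longrightarrow> T x y p \<in> linear_maps (length x) (length y)"
    and T_eq: "p \<in> lin_hom C x y \<Longrightarrow> q \<in> lin_hom C x y \<Longrightarrow> esing_eq C x y p q \<Longrightarrow> T x y p = T x y q"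
    and T_add: "p \<in> lin_hom C x y \<Longrightarrow> q \<in> lin_hom C x y \<Longrightarrow>
      T x y (p + q) = hom_add (length x) (T x y p) (T x y q)"
    and T_scale: "p \<in> lin_hom C x y \<Longrightarrow> T x y (lin_scale r p) = hom_scale (length x) r (T x y p)"
    and T_id: "T x x (lin_cob (Id C x)) = (\<lambda>t \<in> tensor_power (length x). t)"
    and T_comp: "p \<in> lin_hom C x y \<Longrightarrow> q \<in> lin_hom C y z \<Longrightarrow>
      T x z (lin_comp C q p) = compose (tensor_power (length x)) (T y z q) (T x y p)"
    and T_tens: "p \<in> lin_hom C x y \<Longrightarrow> q \<in> lin_hom C x' y' \<Longrightarrow>
      s \<in> tensor_power (length x) \<Longrightarrow> t \<in> tensor_power (length x') \<Longrightarrow>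
      T (x @ x') (y @ y') (lin_tens C p q) (s * t) = T x y p s * T x' y' q t"
    and T_perm: "s \<in> tensor_power (length x) \<Longrightarrow> t \<in> tensor_power (length y) \<Longrightarrow>
      T (x @ y) (y @ x) (lin_cob (Perm C x y)) (s * t) = t * s"
    and T_circle: "c \<in> {Circ_minus, Circ_plus} \<Longrightarrow> T [] [c] (lin_cob (Unit C c)) = iota"
      "c \<in> {Circ_minus, Circ_plus} \<Longrightarrow> T [c] [] (lin_cob (Counit C c)) = eps_C"
      "c \<in> {Circ_minus, Circ_plus} \<Longrightarrow> T [c, c] [c] (lin_cob (Mult C c)) = mult"
      "c \<in> {Circ_minus, Circ_plus} \<Longrightarrow> T [c] [c, c] (lin_cob (Comult C c)) = Delta_C"
    and T_bi_web: "T [] [Bi_web] (lin_cob (Unit C Bi_web)) = iota"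
      "T [Bi_web] [] (lin_cob (Counit C Bi_web)) = eps_W"
      "T [Bi_web, Bi_web] [Bi_web] (lin_cob (Mult C Bi_web)) = mult"
      "T [Bi_web] [Bi_web, Bi_web] (lin_cob (Comult C Bi_web)) = Delta_W"
    and T_zip: "T [Circ_minus] [Bi_web] (lin_cob (Zip_minus C)) = z1"
      "T [Bi_web] [Circ_minus] (lin_cob (Cozip_minus C)) = z1_star"
      "T [Circ_plus] [Bi_web] (lin_cob (Zip_plus C)) = z2"
      "T [Bi_web] [Circ_plus] (lin_cob (Cozip_plus C)) = z2_star"

definition cob_H :: "'m cob \<Rightarrow> ob \<Rightarrow> 'm" where
  "cob_H C c = Comp C (Mult C c) (Comult C c)"

definition cob_F :: "'m cob \<Rightarrow> 'm" where
  "cob_F C = Comp C (Cozip_plus C) (Zip_minus C)"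

end

theory Submission
  imports Defs
begin

text \<open>
  As a module, \<open>\<A>\<close> is free on \<open>1, X\<close>, so each of the circle cobordisms becomes a map that is
  determined by two coordinates. The composite \<open>H = m \<circ> \<Delta>\<close> is multiplication by the handle element
  \<open>m (\<Delta> 1) = 2X - h\<close>, the derivative of the polynomial \<open>X\<^sup>2 - hX - a\<close>; its square is the discriminant
  \<open>h\<^sup>2 + 4a\<close>, which is (G2). The composite \<open>F = z\<^sub>2\<^sup>* \<circ> z\<^sub>1\<close> is \<open>i\<close> times the conjugation
  \<open>X \<mapsto> h - X\<close> exchanging the two roots. Conjugation negates the handle element, which accounts
  for the opposite signs of the two one-handle values in (UFO). Since \<open>\<epsilon>\<close> reads off the coefficient
  of \<open>X\<close>, the values in (S), (T) and (UFO) follow. For (SF), \<open>1\<close> is sent to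
  \<open>\<epsilon> (2X - h) / 2 = 1\<close> by the first summand and to \<open>0\<close> by the second, while
  \<open>X\<close> is sent to \<open>\<epsilon> (hX + 2a) / 2 + (2X - h) / 2 = X\<close>.

  What has to be supplied before this calculation applies is the identification of the low tensor
  powers: every tensor of degree \<open>0\<close> is a scalar and every tensor of degree \<open>1\<close> is an element
  of \<open>\<A>\<close> (\<open>tensor_power_0_cases\<close>, \<open>tensor_power_1_cases\<close>). The functor properties then turn
  a composite of cobordisms into a composite of maps, and the two formulas
  \<open>T_cob_H_coords\<close> and \<open>T_cob_F_coords\<close> reduce every relation to an identity in \<open>R\<close>.
\<close>

section \<open>Tensor powers of low degree\<close>

lemma of_R_mult_coords:
  "of_R k * (of_R r + of_R s * X_A) = of_R (k * r) + of_R (k * s) * X_A"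
  by (simp add: of_R_hom algebra_simps)

lemma abs_tensor_hom:
  "abs_tensor (p + q) = abs_tensor p + abs_tensor q"
  "abs_tensor (p * q) = abs_tensor p * abs_tensor q"
  by (simp_all add: plus_tensor.abs_eq times_tensor.abs_eq)

lemma inj_A_add: "inj_A (x + y) = inj_A x + inj_A y"
  unfolding inj_A_def abs_tensor_hom(1)[symmetric] tensor.abs_eq_iff tensor_rel_def
  by (rule tensor_null.add)

lemma inj_A_scale: "inj_A (of_R r * x) = scal r * inj_A x"
  unfolding inj_A_def scal_def abs_tensor_hom(2)[symmetric] tensor.abs_eq_iff tensor_rel_def
  by (rule tensor_null.scale)

lemma inj_A_zero: "inj_A 0 = 0"
  using inj_A_add[of 0 0] by simp

lemma scal_hom: "scal 0 = 0" "scal 1 = 1" "scal (r + s) = scal r + scal s"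
  "scal (r * s) = scal r * scal s"
  unfolding scal_def
  by (simp_all add: zero_tensor.abs_eq one_tensor.abs_eq single_add
      abs_tensor_hom[symmetric] mult_single)

lemma scal_uminus: "scal (- r) = - scal r"
  using scal_hom(3)[of r "- r"] by (simp add: scal_hom(1) eq_neg_iff_add_eq_0 add.commute)

lemma scal_in_tensor_power_0: "scal r \<in> tensor_power 0"
  unfolding tensor_power_def scal_def
  by (rule imageI) (simp add: zero_word_def)

lemma inj_A_in_tensor_power_1: "inj_A x \<in> tensor_power 1"
  unfolding tensor_power_def inj_A_def
  by (rule imageI) (simp add: letter_def)

lemma tensor_power_add:
  assumes "s \<in> tensor_power n" "t \<in> tensor_power n"
  shows "s + t \<in> tensor_power n"
proof -
  obtain p q where st: "s = abs_tensor p" "t = abs_tensor q"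
    and pq: "\<forall>w \<in> Poly_Mapping.keys p. length (letters w) = n"
      "\<forall>w \<in> Poly_Mapping.keys q. length (letters w) = n"
    using assms unfolding tensor_power_def by blast
  have "\<forall>w \<in> Poly_Mapping.keys (p + q). length (letters w) = n"
    using Poly_Mapping.keys_add[of p q] pq by blast
  then show ?thesis
    unfolding st abs_tensor_hom(1)[symmetric] tensor_power_def by blast
qed

lemma tensor_power_mult:
  assumes "s \<in> tensor_power m" "t \<in> tensor_power n"
  shows "s * t \<in> tensor_power (m + n)"
proof -
  obtain p q where st: "s = abs_tensor p" "t = abs_tensor q"
    and pq: "\<forall>w \<in> Poly_Mapping.keys p. length (letters w) = m"
      "\<forall>w \<in> Poly_Mapping.keys q. length (letters w) = n"
    using assms unfolding tensor_power_def by blast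
  have "\<forall>w \<in> Poly_Mapping.keys (p * q). length (letters w) = m + n"
    using keys_mult[of p q] pq by (fastforce simp: plus_word_def)
  then show ?thesis
    unfolding st abs_tensor_hom(2)[symmetric] tensor_power_def by blast
qed

lemma tensor_power_scale: "t \<in> tensor_power n \<Longrightarrow> scal r * t \<in> tensor_power n"
  using tensor_power_mult[OF scal_in_tensor_power_0] by fastforce

lemma tensor_power_diff:
  assumes "s \<in> tensor_power n" "t \<in> tensor_power n"
  shows "s - t \<in> tensor_power n"
  using tensor_power_add[OF assms(1) tensor_power_scale[OF assms(2), of "- 1"]]
  by (simp add: scal_uminus scal_hom)

text \<open>
  The only word of length \<open>0\<close> is the empty word, so only multiples of the unit have degree \<open>0\<close>.
\<close>

lemma tensor_power_0_cases:
  assumes "t \<in> tensor_power 0"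
  obtains r where "t = scal r"
proof -
  obtain p where t: "t = abs_tensor p"
    and p: "\<forall>w \<in> Poly_Mapping.keys p. length (letters w) = 0"
    using assms unfolding tensor_power_def by blast
  have "w = 0" if "w \<in> Poly_Mapping.keys p" for w
    using p that by (cases w) (auto simp: zero_word_def)
  then have "p = Poly_Mapping.single 0 (Poly_Mapping.lookup p 0)"
    by (intro poly_mapping_eqI) (auto simp: lookup_single when_def in_keys_iff)
  then show thesis
    using that t unfolding scal_def by metis
qed

text \<open>
  The linearity relations contract a combination of one-letter words to a single letter, and this
  letter is the value of the product map.
\<close>

lemma abs_tensor_degree_1:
  assumes "\<forall>w \<in> Poly_Mapping.keys p. length (letters w) = 1"
  shows "abs_tensor p = inj_A (free_product p)"
  using assms
proof (induction p rule: update_induct)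
  case const
  show ?case by (simp add: free_product_zero inj_A_zero zero_tensor.abs_eq)
next
  case (update p w r)
  have split: "Poly_Mapping.update w r p = Poly_Mapping.single w r + p"
    by (rule poly_mapping_eqI)
      (use update.hyps in \<open>auto simp: lookup_update lookup_add lookup_single in_keys_iff when_def\<close>)
  have keys: "Poly_Mapping.keys (Poly_Mapping.update w r p) = insert w (Poly_Mapping.keys p)"
    using update.hyps by (auto simp: in_keys_iff lookup_update split: if_splits)
  obtain x where w: "w = Word [x]"
    using update.prems keys by (cases w) (auto simp: length_Suc_conv)
  have "Poly_Mapping.single w r = Poly_Mapping.single 0 r * letter x"
    by (simp add: w letter_def mult_single)
  then have "abs_tensor (Poly_Mapping.single w r) = inj_A (of_R r * x)"
    unfolding inj_A_scale by (simp add: abs_tensor_hom scal_def inj_A_def)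
  moreover have "abs_tensor p = inj_A (free_product p)"
    using update keys by blast
  ultimately show ?case
    unfolding split by (simp add: abs_tensor_hom free_product_add free_product_single inj_A_add w)
qed

definition coords :: "R \<Rightarrow> R \<Rightarrow> tensor" where
  "coords r s = inj_A (of_R r + of_R s * X_A)"

lemma tensor_power_1_cases:
  assumes "t \<in> tensor_power 1"
  obtains r s where "t = coords r s"
proof -
  obtain x where "t = inj_A x"
    using assms abs_tensor_degree_1 unfolding tensor_power_def by blast
  then show thesis
    using that basis_exists[of x] unfolding coords_def by blast
qed

lemma coords_in_tensor_power_1 [simp]: "coords r s \<in> tensor_power (Suc 0)"
  using inj_A_in_tensor_power_1 by (simp add: coords_def)

lemma coords_add: "coords r s + coords r' s' = coords (r + r') (s + s')"
  by (simp add: coords_def inj_A_add[symmetric] of_R_hom algebra_simps)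

lemma coords_scale: "scal k * coords r s = coords (k * r) (k * s)"
  by (simp add: coords_def inj_A_scale[symmetric] of_R_mult_coords)


section \<open>The structure maps in coordinates\<close>

lemma basis_map_coords: "basis_map u v (coords r s) = scal r * u + scal s * v"
proof -
  have "mult_A (coords r s) = of_R r + of_R s * X_A"
    by (simp add: coords_def)
  then show ?thesis
    by (simp add: basis_map_def)
qed

lemma iota_scal: "iota (scal r) = coords r 0"
  by (simp add: iota_def scal_in_tensor_power_0 coords_def of_R_hom inj_A_scale[symmetric])

lemma eps_C_coords: "eps_C (coords r s) = scal s"
  by (simp add: eps_C_def basis_map_coords)

lemma mult_Delta_C_coords:
  "mult (Delta_C (coords r s)) = coords (2 * a_R * s - h_R * r) (2 * r + h_R * s)"
proof -
  let ?u = "inj_A 1 * inj_A X_A + inj_A X_A * inj_A 1 - scal h_R * (inj_A 1 * inj_A 1)"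
  let ?v = "inj_A X_A * inj_A X_A + scal a_R * (inj_A 1 * inj_A 1)"
  have deg2: "inj_A x * inj_A y \<in> tensor_power 2" for x y
    using tensor_power_mult[OF inj_A_in_tensor_power_1 inj_A_in_tensor_power_1]
    by (simp add: numeral_2_eq_2)
  have "scal r * ?u + scal s * ?v \<in> tensor_power 2"
    by (intro tensor_power_add tensor_power_diff tensor_power_scale deg2)
  then have "mult (Delta_C (coords r s)) = inj_A (mult_A (scal r * ?u + scal s * ?v))"
    by (simp add: Delta_C_def basis_map_coords mult_def)
  also have "mult_A ?u = of_R (- h_R) + of_R 2 * X_A"
  proof -
    have "mult_A ?u + of_R h_R = X_A + X_A"
      using mult_A_hom(1)[of ?u "scal h_R * (inj_A 1 * inj_A 1)"] by (simp add: mult_A_hom)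
    moreover have "of_R 2 * X_A = X_A + X_A"
      using of_R_hom(3)[of 1 1] by (simp add: of_R_hom(2) distrib_right)
    ultimately show ?thesis
      by (simp add: of_R_hom(5) eq_diff_eq)
  qed
  then have "mult_A (scal r * ?u + scal s * ?v)
      = of_R r * (of_R (- h_R) + of_R 2 * X_A) + of_R s * (of_R h_R * X_A + of_R a_R + of_R a_R)"
    by (simp add: mult_A_hom X_A_square add.assoc)
  also have "\<dots> = of_R (2 * a_R * s - h_R * r) + of_R (2 * r + h_R * s) * X_A"
  proof -
    have "of_R 2 = 1 + 1"
      using of_R_hom(3)[of 1 1] by (simp add: of_R_hom(2))
    then show ?thesis
      by (simp add: of_R_hom algebra_simps)
  qed
  finally show ?thesis
    by (simp add: coords_def)
qed

lemma z1_coords: "z1 (coords r s) = coords r s"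
  unfolding z1_def basis_map_coords
  by (simp add: inj_A_scale[symmetric] inj_A_add[symmetric] coords_def)

lemma z2_star_coords: "z2_star (coords r s) = coords (i_R * (r + h_R * s)) (- (i_R * s))"
  unfolding z2_star_def basis_map_coords
  by (simp add: inj_A_scale[symmetric] inj_A_add[symmetric] coords_def of_R_hom algebra_simps)


section \<open>Evaluating the functor on composites\<close>

lemma lin_comp_lin_cob: "lin_comp C (lin_cob g) (lin_cob f) = lin_cob (Comp C g f)"
  by (simp add: lin_comp_def lin_cob_def)

lemma lin_cob_in_lin_hom: "f \<in> Hom C x y \<Longrightarrow> lin_cob f \<in> lin_hom C x y"
  by (simp add: lin_hom_def lin_cob_def)

context foam_functor
begin

lemma Comp_in_Hom: "f \<in> Hom C x y \<Longrightarrow> g \<in> Hom C y z \<Longrightarrow> Comp C g f \<in> Hom C x z"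
  unfolding hom_generated by (rule generated.intros)

lemma generator_in_Hom:
  "Unit C c \<in> Hom C [] [c]" "Counit C c \<in> Hom C [c] []"
  "Mult C c \<in> Hom C [c, c] [c]" "Comult C c \<in> Hom C [c] [c, c]"
  "Zip_minus C \<in> Hom C [Circ_minus] [Bi_web]" "Cozip_plus C \<in> Hom C [Bi_web] [Circ_plus]"
  unfolding hom_generated by (rule generated.intros)+

lemma T_Comp:
  assumes "f \<in> Hom C x y" "g \<in> Hom C y z" "t \<in> tensor_power (length x)"
  shows "T x z (lin_cob (Comp C g f)) t = T y z (lin_cob g) (T x y (lin_cob f) t)"
  using T_comp[OF assms(1,2)[THEN lin_cob_in_lin_hom]] assms(3)
  by (simp add: lin_comp_lin_cob compose_eq)

lemma cob_H_in_Hom: "cob_H C c \<in> Hom C [c] [c]"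
  unfolding cob_H_def by (rule Comp_in_Hom[OF generator_in_Hom(4,3)])

lemma cob_F_in_Hom: "cob_F C \<in> Hom C [Circ_minus] [Circ_plus]"
  unfolding cob_F_def by (rule Comp_in_Hom[OF generator_in_Hom(5,6)])

text \<open>Multiplication of \<open>r + s X\<close> by the handle element \<open>2X - h\<close>, reduced by \<open>X\<^sup>2 = hX + a\<close>.\<close>

lemma T_cob_H_coords:
  assumes "c \<in> {Circ_minus, Circ_plus}"
  shows "T [c] [c] (lin_cob (cob_H C c)) (coords r s)
    = coords (2 * a_R * s - h_R * r) (2 * r + h_R * s)"
  unfolding cob_H_def
  by (subst T_Comp[OF generator_in_Hom(4,3)])
    (simp_all add: T_circle[OF assms] mult_Delta_C_coords)

text \<open>
  \<open>F\<close> is \<open>i\<close> times the conjugation \<open>X \<mapsto> h - X\<close>, under which \<open>r + s X\<close> becomes \<open>(r + h s) - s X\<close>.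
\<close>

lemma T_cob_F_coords:
  "T [Circ_minus] [Circ_plus] (lin_cob (cob_F C)) (coords r s)
    = coords (i_R * (r + h_R * s)) (- (i_R * s))"
  unfolding cob_F_def
  by (subst T_Comp[OF generator_in_Hom(5,6)])
    (simp_all add: T_zip z1_coords z2_star_coords)

text \<open>
  The intermediate object of a composite cannot be read off the composite. Fixing the last factor
  determines it, so that these rules evaluate a right-nested composite by rewriting.
\<close>

lemma Comp_last_in_Hom:
  "f \<in> Hom C x [] \<Longrightarrow> Comp C (Unit C c) f \<in> Hom C x [c]"
  "f \<in> Hom C x [c] \<Longrightarrow> Comp C (Counit C c) f \<in> Hom C x []"
  "f \<in> Hom C x [c] \<Longrightarrow> Comp C (cob_H C c) f \<in> Hom C x [c]"
  "f \<in> Hom C x [Circ_minus] \<Longrightarrow> Comp C (cob_F C) f \<in> Hom C x [Circ_plus]"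
  by (blast intro: Comp_in_Hom generator_in_Hom cob_H_in_Hom cob_F_in_Hom)+

lemmas T_Comp_last =
  T_Comp[OF _ generator_in_Hom(1)] T_Comp[OF _ generator_in_Hom(2)]
  T_Comp[OF _ cob_H_in_Hom] T_Comp[OF _ cob_F_in_Hom]

lemmas evaluation =
  T_Comp_last Comp_last_in_Hom generator_in_Hom(1,2) cob_H_in_Hom
  T_cob_H_coords T_cob_F_coords T_circle iota_scal eps_C_coords scal_in_tensor_power_0

lemma T_extensional:
  "f \<in> Hom C x y \<Longrightarrow> T x y (lin_cob f) \<in> extensional (tensor_power (length x))"
  using T_linear_map[OF lin_cob_in_lin_hom] by (auto simp: linear_maps_def PiE_def)

lemma T_closed_eqI:
  assumes "f \<in> Hom C [] []" "\<And>k. T [] [] (lin_cob f) (scal k) = scal (r * k)"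
  shows "T [] [] (lin_cob f) = ground_map r"
proof (rule extensionalityI)
  show "T [] [] (lin_cob f) \<in> extensional (tensor_power 0)"
    using T_extensional[OF assms(1)] by simp
  show "ground_map r \<in> extensional (tensor_power 0)"
    by (simp add: ground_map_def)
  show "T [] [] (lin_cob f) t = ground_map r t" if "t \<in> tensor_power 0" for t
    using that assms(2)
    by (cases rule: tensor_power_0_cases) (simp add: ground_map_def scal_in_tensor_power_0 scal_hom)
qed

text \<open>Each handle multiplies by \<open>2X - h\<close>, and \<open>(2X - h)\<^sup>2 = h\<^sup>2 + 4a\<close>.\<close>

lemma T_genus_two_reduction:
  assumes "c \<in> {Circ_minus, Circ_plus}"
  shows "T [] [c] (lin_cob (Comp C (cob_H C c) (Comp C (cob_H C c) (Unit C c))))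
    = hom_scale 0 (h_R ^ 2 + 4 * a_R) (T [] [c] (lin_cob (Unit C c)))" (is "?l = ?r")
proof (rule extensionalityI)
  have "Comp C (cob_H C c) (Comp C (cob_H C c) (Unit C c)) \<in> Hom C [] [c]"
    by (simp add: evaluation)
  then show "?l \<in> extensional (tensor_power 0)"
    using T_extensional by fastforce
  show "?r \<in> extensional (tensor_power 0)"
    by (simp add: hom_scale_def)
  show "?l t = ?r t" if "t \<in> tensor_power 0" for t
    using that
  proof (cases rule: tensor_power_0_cases)
    case (1 k)
    then show ?thesis
      using assms
      by (simp add: evaluation hom_scale_def coords_scale algebra_simps power2_eq_square)
  qed
qed

text \<open>
  On \<open>r + s X\<close> the first summand yields the constant \<open>r + h s / 2\<close> and the second yields
  \<open>s (2X - h) / 2\<close>, whose constant term cancels \<open>h s / 2\<close>.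
\<close>

lemma T_surgery:
  assumes "c \<in> {Circ_minus, Circ_plus}"
  shows "T [c] [c] (lin_cob (Id C [c]))
    = hom_add 1
        (hom_scale 1 half_R (T [c] [c] (lin_cob (Comp C (Unit C c) (Comp C (Counit C c) (cob_H C c))))))
        (hom_scale 1 half_R (T [c] [c] (lin_cob (Comp C (cob_H C c) (Comp C (Unit C c) (Counit C c))))))"
    (is "?l = ?r")
proof (rule extensionalityI)
  show "?l \<in> extensional (tensor_power 1)"
    by (simp add: T_id)
  show "?r \<in> extensional (tensor_power 1)"
    by (simp add: hom_add_def)
  show "?l t = ?r t" if "t \<in> tensor_power 1" for t
    using that
  proof (cases rule: tensor_power_1_cases)
    case (1 r s)
    have half: "half_R * (2 * x) = x" for x
      using two_half_R by (metis mult.assoc mult.commute mult_1)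
    have "half_R * (2 * r + h_R * s) + half_R * - (h_R * s) = r"
      by (simp add: distrib_left half)
    then show ?thesis
      using assms 1
      by (simp add: evaluation T_id hom_add_def hom_scale_def coords_scale coords_add half)
  qed
qed

end

section \<open>The local relations\<close>

theorem proposition4:
  fixes C :: "'m cob"
    and T :: "ob list \<Rightarrow> ob list \<Rightarrow> ('m \<Rightarrow>\<^sub>0 R) \<Rightarrow> tensor \<Rightarrow> tensor"
  assumes "foam_functor C T"
  shows
    "(\<forall>c \<in> {Circ_minus, Circ_plus}.
        T [] [] (lin_cob (Comp C (Counit C c) (Unit C c))) = ground_map 0) \<and>
     (\<forall>c \<in> {Circ_minus, Circ_plus}.
        T [] [] (lin_cob (Comp C (Counit C c) (Comp C (cob_H C c) (Unit C c)))) = ground_map 2) \<and>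
     (T [] [] (lin_cob (Comp C (Counit C Circ_plus) (Comp C (cob_F C) (Unit C Circ_minus))))
        = ground_map 0 \<and>
      T [] [] (lin_cob (Comp C (Counit C Circ_plus) (Comp C (cob_H C Circ_plus)
          (Comp C (cob_F C) (Comp C (cob_H C Circ_minus) (Unit C Circ_minus))))))
        = ground_map 0 \<and>
      T [] [] (lin_cob (Comp C (Counit C Circ_plus) (Comp C (cob_H C Circ_plus)
          (Comp C (cob_F C) (Unit C Circ_minus)))))
        = ground_map (2 * i_R) \<and>
      T [] [] (lin_cob (Comp C (Counit C Circ_plus) (Comp C (cob_F C)
          (Comp C (cob_H C Circ_minus) (Unit C Circ_minus)))))
        = ground_map (- 2 * i_R)) \<and>
     (\<forall>c \<in> {Circ_minus, Circ_plus}.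
        T [] [c] (lin_cob (Comp C (cob_H C c) (Comp C (cob_H C c) (Unit C c))))
        = hom_scale 0 (h_R ^ 2 + 4 * a_R) (T [] [c] (lin_cob (Unit C c)))) \<and>
     (\<forall>c \<in> {Circ_minus, Circ_plus}.
        T [c] [c] (lin_cob (Id C [c]))
        = hom_add 1
            (hom_scale 1 half_R (T [c] [c] (lin_cob (Comp C (Unit C c) (Comp C (Counit C c) (cob_H C c))))))
            (hom_scale 1 half_R (T [c] [c] (lin_cob (Comp C (cob_H C c) (Comp C (Unit C c) (Counit C c)))))))"
proof -
  interpret foam_functor C T by fact
  show ?thesis
  proof (intro conjI ballI)
    fix c assume c: "c \<in> {Circ_minus, Circ_plus}"
    show "T [] [] (lin_cob (Comp C (Counit C c) (Unit C c))) = ground_map 0"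
      by (rule T_closed_eqI) (use c in \<open>simp_all add: evaluation\<close>)
    show "T [] [] (lin_cob (Comp C (Counit C c) (Comp C (cob_H C c) (Unit C c)))) = ground_map 2"
      by (rule T_closed_eqI) (use c in \<open>simp_all add: evaluation\<close>)
  next
    fix c assume "c \<in> {Circ_minus, Circ_plus}"
    then show "T [] [c] (lin_cob (Comp C (cob_H C c) (Comp C (cob_H C c) (Unit C c))))
        = hom_scale 0 (h_R ^ 2 + 4 * a_R) (T [] [c] (lin_cob (Unit C c)))"
      by (rule T_genus_two_reduction)
  next
    fix c assume "c \<in> {Circ_minus, Circ_plus}"
    then show "T [c] [c] (lin_cob (Id C [c]))
        = hom_add 1
            (hom_scale 1 half_R (T [c] [c] (lin_cob (Comp C (Unit C c) (Comp C (Counit C c) (cob_H C c))))))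
            (hom_scale 1 half_R (T [c] [c] (lin_cob (Comp C (cob_H C c) (Comp C (Unit C c) (Counit C c))))))"
      by (rule T_surgery)
  qed (rule T_closed_eqI, simp_all add: evaluation algebra_simps)+
qed

end
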